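(* Let $k \ge 2$ be an integer. For integers $m,n\ge 0$, let $D_k(m,n)$ be the number of overpartitions of $n$ with exactly $m$ overlined parts, subject to the following conditions: (i) if an overlined part $\overline{b}$ appears, then all of the non-overlined parts $b, b+1,\dots, b+k-2$ are forbidden to appear; (ii) if an overlined part $\overline{b}$ appears, then all of the overlined parts $\overline{b+1},\overline{b+2},\dots,\overline{b+k-1}$ are forbidden to appear. Then, as an identity of formal power series in $a$ and $q$, \[\sum_{m,n \ge 0} D_k(m,n)\,a^m q^n = \frac{\left(-aq;q^k\right)_{\infty}}{(q;q)_{\infty}}.\]
   Context: An overpartition of a non-negative integer $n$ is a partition of $n$ (a finite multiset of positive integers with sum $n$; the empty partition is the only partition of $0$) in which the last occurrence of each part size may or may not be overlined. Thus each part size $b$ has at most one overlined copy $\overline{b}$ (contributing $b$ to the sum), and any number of non-overlined copies. The $q$-Pochhammer symbol is $(b;q)_t = \prod_{0\le m<t}(1-bq^m)$, where $t$ is a non-negative integer or $\infty$; so $(-aq;q^k)_\infty=\prod_{m\ge 0}(1+aq^{km+1})$ and $(q;q)_\infty=\prod_{m\ge 1}(1-q^m)$. *)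

theory Defs
  imports "HOL-Analysis.Infinite_Products"
    "HOL-Computational_Algebra.Formal_Power_Series"
    "HOL-Library.Multiset"
begin

text \<open>An overpartition is a pair \<open>(P, S)\<close>: \<open>P\<close> is the underlying partition (all parts, overlined
  or not), and \<open>S\<close> is the set of those part sizes whose last occurrence in \<open>P\<close> is overlined.\<close>

definition overpartitions :: "nat \<Rightarrow> (nat multiset \<times> nat set) set" where
  "overpartitions n =
     {(P, S). (\<forall>b \<in># P. 0 < b) \<and> sum_mset P = n \<and> S \<subseteq> set_mset P}"

fun overlined_parts :: "nat multiset \<times> nat set \<Rightarrow> nat set" where
  "overlined_parts (P, S) = S"

fun nonoverlined_parts :: "nat multiset \<times> nat set \<Rightarrow> nat multiset" where
  "nonoverlined_parts (P, S) = P - mset_set S"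

definition D :: "nat \<Rightarrow> nat \<Rightarrow> nat \<Rightarrow> nat" where
  "D k m n = card {\<pi> \<in> overpartitions n.
     card (overlined_parts \<pi>) = m \<and>
     (\<forall>b \<in> overlined_parts \<pi>. \<forall>c \<in> {b..b + k - 2}. c \<notin># nonoverlined_parts \<pi>) \<and>
     (\<forall>b \<in> overlined_parts \<pi>. \<forall>c \<in> {b + 1..b + k - 1}. c \<notin> overlined_parts \<pi>)}"

text \<open>Power series in \<open>a\<close> and \<open>q\<close> are represented as power series in \<open>q\<close> whose coefficients are power
  series in \<open>a\<close>; the rationals serve as scalars because division of power series needs an
  \<open>inverse\<close> operation on the scalars.\<close>

abbreviation var_a :: "rat fps fps" where
  "var_a \<equiv> fps_const fps_X"

abbreviation var_q :: "rat fps fps" where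
  "var_q \<equiv> fps_X"

definition gen_fun :: "(nat \<Rightarrow> nat \<Rightarrow> nat) \<Rightarrow> rat fps fps" where
  "gen_fun f = Abs_fps (\<lambda>n. Abs_fps (\<lambda>m. of_nat (f m n)))"

text \<open>On power series, \<open>prodinf\<close> is the limit of the partial products in the \<open>q\<close>-adic metric.\<close>

definition qpochhammer_inf :: "rat fps fps \<Rightarrow> rat fps fps \<Rightarrow> rat fps fps" where
  "qpochhammer_inf b x = (\<Prod>m. 1 - b * x ^ m)"

end

theory Submission
  imports Defs
begin

text \<open>Split off the smallest part size: let \<open>A\<^sub>N\<close> be the generating function of the admissible
  overpartitions whose non-overlined parts are at least \<open>N\<close> and whose overlined parts exceed \<open>N\<close>.
  Deciding whether \<open>N\<close> occurs, and then whether \<open>N + 1\<close> is overlined, gives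
  \<open>(1 - q^N) A\<^sub>N = A\<^sub>N\<^sub>+\<^sub>1 + a q^(N+1) A\<^sub>N\<^sub>+\<^sub>k\<close>. Together with \<open>A\<^sub>N = 1\<close> modulo \<open>q^N\<close> this
  determines all \<open>A\<^sub>N\<close> with \<open>N \<ge> 1\<close>. With \<open>P = (-aq; q^k)\<^sub>\<infinity>\<close> the solution is
  \<open>A\<^sub>N = P \<Sum>\<^sub>j (-aq)^j / ((q^k; q^k)\<^sub>j (q^(N+kj); q)\<^sub>\<infinity>)\<close>,
  where the initial condition is Euler's identity \<open>P \<Sum>\<^sub>j (-aq)^j / (q^k; q^k)\<^sub>j = 1\<close>. The generating
  function in question is \<open>A\<^sub>1 + a q A\<^sub>k\<close>, in which the two sums telescope to \<open>P / (q; q)\<^sub>\<infinity>\<close>.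
  All sums over \<open>j\<close> are truncated at some \<open>J\<close> and the identities are read modulo \<open>q^J\<close>.\<close>

unbundle no vec_syntax and fps_syntax

section \<open>Congruences modulo powers of \<open>q\<close>\<close>

lemma fps_X_power_dvd_iff:
  fixes f :: "'a::comm_ring_1 fps"
  shows "fps_X ^ n dvd f \<longleftrightarrow> (\<forall>i<n. f $ i = 0)"
proof
  assume "fps_X ^ n dvd f"
  then show "\<forall>i<n. f $ i = 0"
    by (auto simp: dvd_def fps_X_power_mult_nth)
next
  assume "\<forall>i<n. f $ i = 0"
  then have "f = fps_X ^ n * fps_shift n f"
    by (simp add: fps_eq_iff fps_X_power_mult_nth)
  then show "fps_X ^ n dvd f" by (rule dvdI)
qed

lemma fps_X_power_dvd_diff_iff:
  fixes f g :: "'a::comm_ring_1 fps"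
  shows "fps_X ^ n dvd f - g \<longleftrightarrow> (\<forall>i<n. f $ i = g $ i)"
  by (simp add: fps_X_power_dvd_iff)

lemma fps_eqI_fps_X_power_dvd:
  fixes f g :: "'a::comm_ring_1 fps"
  assumes "\<And>n. fps_X ^ n dvd f - g"
  shows "f = g"
proof (rule fps_ext)
  fix n
  show "f $ n = g $ n"
    using assms[of "Suc n"] unfolding fps_X_power_dvd_diff_iff by simp
qed

lemma dvd_diff_trans:
  fixes d :: "'a::comm_ring_1"
  assumes "d dvd x - y" "d dvd y - z"
  shows "d dvd x - z"
  using dvd_add[OF assms] by simp

lemma dvd_diff_mult:
  fixes d :: "'a::comm_ring_1"
  assumes "d dvd x - y" "d dvd x' - y'"
  shows "d dvd x * x' - y * y'"
proof -
  have "x * x' - y * y' = (x - y) * x' + y * (x' - y')" by (simp add: algebra_simps)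
  then show ?thesis using assms by simp
qed

text \<open>The coefficients are themselves power series, so a nonzero constant coefficient need not
  be invertible; the coefficient 1 is its own inverse.\<close>

lemma fps_mult_inverse_of_unit_constant:
  fixes f :: "'a::field fps fps"
  assumes "f $ 0 = 1"
  shows "f * inverse f = 1"
  using assms fps_right_inverse[of f 1] fps_inverse_one' by (simp add: fps_inverse_def[of f])

section \<open>Infinite \<open>q\<close>-Pochhammer symbols\<close>

text \<open>Factor \<open>m\<close> is 1 modulo \<open>q^m\<close>, so the factors from index
  \<open>n\<close> on leave the coefficients below \<open>n\<close> unchanged.\<close>

lemma qpochhammer_inf_dvd:
  assumes b: "fps_X dvd b" and x: "fps_X dvd x"
  shows "fps_X ^ n dvd qpochhammer_inf b x - (\<Prod>m<n. 1 - b * x ^ m)"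
proof -
  define p where "p n = (\<Prod>m<n. 1 - b * x ^ m)" for n
  \<comment> \<open>The first \<open>n + 1\<close> factors settle all coefficients up to index
    \<open>n\<close>, hence \<open>Suc n\<close>.\<close>
  define L where "L = Abs_fps (\<lambda>n. p (Suc n) $ n)"
  have step: "fps_X ^ n dvd p (n + d) - p n" for n d
  proof (induction d)
    case (Suc d)
    have "fps_X ^ n dvd b * x ^ (n + d)"
      using x by (meson dvd_mult dvd_power_same le_add1 dvd_trans le_imp_power_dvd)
    moreover have "p (n + Suc d) - p (n + d) = - (p (n + d) * (b * x ^ (n + d)))"
      by (simp add: p_def algebra_simps)
    ultimately have "fps_X ^ n dvd p (n + Suc d) - p (n + d)"
      by simp
    then show ?case using Suc dvd_diff_trans by blast
  qed simp
  have stable: "p n $ i = L $ i" if "i < n" for n i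
    using step[of "Suc i" "n - Suc i"] that
    unfolding fps_X_power_dvd_diff_iff by (simp add: L_def)
  have "(\<lambda>n. \<Prod>i\<le>n. 1 - b * x ^ i) \<longlonglongrightarrow> L"
  proof (rule tendsto_fpsI)
    fix i
    show "\<forall>\<^sub>F n in sequentially. (\<Prod>i\<le>n. 1 - b * x ^ i) $ i = L $ i"
      using eventually_ge_at_top[of i]
    proof eventually_elim
      case (elim n)
      then show ?case
        using stable[of i "Suc n"] by (simp only: p_def lessThan_Suc_atMost less_Suc_eq_le)
    qed
  qed
  \<comment> \<open>\<open>raw_has_prod\<close> demands a nonzero limit; the constant coefficient 1
    ensures this.\<close>
  moreover have "b $ 0 = 0" using b fps_X_power_dvd_iff[of 1 b] by simp
  then have "L $ 0 = 1" by (simp add: L_def p_def)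
  then have "L \<noteq> 0" by auto
  ultimately have "(\<lambda>m. 1 - b * x ^ m) has_prod L"
    by (simp add: has_prod_def raw_has_prod_def)
  then have "qpochhammer_inf b x = L"
    by (simp add: qpochhammer_inf_def has_prod_unique[symmetric])
  then show ?thesis
    using stable by (simp add: fps_X_power_dvd_iff p_def)
qed

lemma qpochhammer_inf_nth_0:
  assumes "fps_X dvd b" "fps_X dvd x"
  shows "qpochhammer_inf b x $ 0 = 1"
  using qpochhammer_inf_dvd[OF assms, of 1] fps_X_power_dvd_iff[of 1 b] assms
  unfolding fps_X_power_dvd_diff_iff by simp

section \<open>The solution of the recurrence\<close>

text \<open>Here \<open>V j\<close> stands for \<open>1 / (q^k; q^k)_j\<close> and \<open>R N\<close> for \<open>1 / (q^N; q)_\<infinity>\<close>.\<close>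

locale q_recurrence =
  fixes q a :: "'a::comm_ring_1" and k :: nat and V R :: "nat \<Rightarrow> 'a"
  assumes V_0: "V 0 = 1"
    and V_Suc: "(1 - q ^ (k * Suc j)) * V (Suc j) = V j"
    and R_Suc: "1 \<le> N \<Longrightarrow> (1 - q ^ N) * R N = R (Suc N)"
    and k_pos: "1 \<le> k"
begin

text \<open>Truncation of Euler's series for
  \<open>1 / (-a q^(k i + 1); q^k)_\<infinity>\<close>.\<close>

definition euler_sum :: "nat \<Rightarrow> nat \<Rightarrow> 'a" where
  "euler_sum i J = (\<Sum>j<J. (- a * q ^ (k * i + 1)) ^ j * V j)"

definition sol_term :: "nat \<Rightarrow> nat \<Rightarrow> 'a" where
  "sol_term N j = (- a * q) ^ j * V j * R (N + k * j)"

definition sol :: "nat \<Rightarrow> nat \<Rightarrow> 'a" where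
  "sol J N = (\<Sum>j<J. sol_term N j)"

text \<open>With \<open>z = -a q^(k i + 1)\<close>, \<open>V_Suc\<close> turns
  \<open>z^j (1 - q^(k j)) V j\<close> into \<open>z * z^(j-1) V (j-1)\<close>. Hence the full
  series satisfies \<open>(1 - z) E(z) = E(z q^k)\<close>, and truncation leaves one boundary
  term.\<close>

lemma euler_sum_step:
  "(1 + a * q ^ (k * i + 1)) * euler_sum i (Suc J) - euler_sum (Suc i) (Suc J)
     = - ((- a * q ^ (k * i + 1)) ^ Suc J * V J)"
proof (induction J)
  case 0
  then show ?case by (simp add: euler_sum_def V_0)
next
  case (Suc J)
  define y where "y = - a * q ^ (k * i + 1)"
  have y': "- a * q ^ (k * Suc i + 1) = y * q ^ k"
    by (simp add: y_def power_add algebra_simps)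
  have *: "euler_sum i (Suc (Suc J)) = euler_sum i (Suc J) + y ^ Suc J * V (Suc J)"
    by (simp add: euler_sum_def y_def)
  have **: "euler_sum (Suc i) (Suc (Suc J)) =
      euler_sum (Suc i) (Suc J) + y ^ Suc J * q ^ (k * Suc J) * V (Suc J)"
    by (simp only: euler_sum_def y' sum.lessThan_Suc[of _ "Suc J"] power_mult_distrib power_mult)
  have a: "a * q ^ (k * i + 1) = - y" by (simp add: y_def)
  have IH: "(1 + - y) * euler_sum i (Suc J) - euler_sum (Suc i) (Suc J) = - (y ^ Suc J * V J)"
    using Suc.IH unfolding a y_def[symmetric] .
  have "(1 + - y) * euler_sum i (Suc (Suc J)) - euler_sum (Suc i) (Suc (Suc J)) =
     ((1 + - y) * euler_sum i (Suc J) - euler_sum (Suc i) (Suc J)) +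
     y ^ Suc J * ((1 - q ^ (k * Suc J)) * V (Suc J)) - y ^ Suc (Suc J) * V (Suc J)"
    unfolding * ** by (simp add: algebra_simps)
  also have "\<dots> = - (y ^ Suc (Suc J) * V (Suc J))"
    unfolding IH V_Suc by simp
  finally show ?case unfolding a y_def[symmetric] .
qed

text \<open>By \<open>R_Suc\<close>, \<open>(1 - q^N) sol_term N j - sol_term (N+1) j\<close> has
  the factor \<open>-q^N (1 - q^(k j)) V j\<close>, which \<open>V_Suc\<close> lowers to index
  \<open>j - 1\<close>. The result is a term of \<open>sol\<close> at \<open>N + k\<close>, and only
  its last term is unmatched.\<close>

lemma sol_recurrence:
  assumes "1 \<le> N"
  shows "(1 - q ^ N) * sol (Suc J) N - sol (Suc J) (Suc N) - a * q ^ Suc N * sol (Suc J) (N + k)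
     = - (a * q ^ Suc N * sol_term (N + k) J)"
proof (induction J)
  case 0
  then show ?case using R_Suc[OF assms] by (simp add: sol_def sol_term_def V_0)
next
  case (Suc J)
  define r where "r = R (N + k * Suc J)"
  define z where "z = (- a * q) ^ Suc J * V (Suc J)"
  have 1: "sol_term (N + k) J = (- a * q) ^ J * ((1 - q ^ (k * Suc J)) * V (Suc J)) * r"
    unfolding V_Suc by (simp add: sol_term_def r_def add.assoc)
  have 2: "sol_term (Suc N) (Suc J) = z * ((1 - q ^ (N + k * Suc J)) * r)"
    using R_Suc[of "N + k * Suc J"] assms by (simp add: sol_term_def r_def z_def)
  have 3: "sol_term N (Suc J) = z * r"
    by (simp add: sol_term_def r_def z_def)
  have "(1 - q ^ N) * sol_term N (Suc J) - sol_term (Suc N) (Suc J) = a * q ^ Suc N * sol_term (N + k) J"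
    unfolding 1 2 3 z_def by (simp add: algebra_simps power_add)
  moreover have "sol (Suc (Suc J)) M = sol (Suc J) M + sol_term M (Suc J)" for M
    by (simp add: sol_def)
  moreover have "(1 - q ^ N) * (s + t) - (s' + t') - c * (s'' + t'') =
      ((1 - q ^ N) * s - s' - c * s'') + ((1 - q ^ N) * t - t') - c * t''" for s s' s'' t t' t'' c :: 'a
    by (simp add: algebra_simps)
  ultimately show ?case using Suc by (simp only:) (simp add: algebra_simps)
qed

text \<open>Term \<open>j + 1\<close> at 1 cancels \<open>a q\<close> times term \<open>j\<close> at
  \<open>k\<close>: the arguments of \<open>R\<close> differ by one, and the resulting factor
  \<open>1 - q^(k (j+1))\<close> lowers the index of \<open>V\<close>.\<close>

lemma sol_total:
  "sol (Suc J) 1 + a * q * sol (Suc J) k = R 1 + a * q * sol_term k J"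
proof (induction J)
  case 0
  then show ?case by (simp add: sol_def sol_term_def V_0)
next
  case (Suc J)
  define r where "r = R (k * Suc J)"
  have 1: "sol_term k J = (- a * q) ^ J * ((1 - q ^ (k * Suc J)) * V (Suc J)) * r"
    unfolding V_Suc by (simp add: sol_term_def r_def)
  have 2: "sol_term 1 (Suc J) = (- a * q) ^ Suc J * V (Suc J) * ((1 - q ^ (k * Suc J)) * r)"
    using R_Suc[of "k * Suc J"] k_pos by (simp add: sol_term_def r_def)
  have 3: "sol_term 1 (Suc J) = - (a * q * sol_term k J)"
    unfolding 1 2 by (simp add: algebra_simps)
  have "sol (Suc (Suc J)) N = sol (Suc J) N + sol_term N (Suc J)" for N
    by (simp add: sol_def)
  moreover have "(s + t) + c * (s' + t') = (s + c * s') + t + c * t'" for s s' t t' c :: 'a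
    by (simp add: algebra_simps)
  ultimately show ?case using Suc 3 by (simp only:) simp
qed

lemma sol_term_dvd: "q ^ j dvd sol_term N j"
  by (simp only: sol_term_def dvd_mult2 dvd_power_same dvd_triv_right)

lemma q_power_dvd_euler_sum_step:
  "q ^ J dvd (1 + a * q ^ (k * i + 1)) * euler_sum i (Suc J) - euler_sum (Suc i) (Suc J)"
proof -
  have "q ^ J dvd (- a * q ^ (k * i + 1)) ^ Suc J * V J"
    by (intro dvd_mult2[of _ "(- a * q ^ (k * i + 1)) ^ Suc J"]
          dvd_trans[OF le_imp_power_dvd[of J "Suc J"] dvd_power_same]) (auto simp: power_add)
  then show ?thesis unfolding euler_sum_step by simp
qed

lemma euler_sum_dvd: "q ^ i dvd euler_sum i (Suc J) - 1"
proof -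
  have "q ^ i dvd (\<Sum>j<J. (- a * q ^ (k * i + 1)) ^ Suc j * V (Suc j))"
  proof (rule dvd_sum)
    fix j
    have "q ^ i dvd q ^ (k * i + 1)"
      using mult_le_mono1[OF k_pos, of i] by (intro le_imp_power_dvd) linarith
    then show "q ^ i dvd (- a * q ^ (k * i + 1)) ^ Suc j * V (Suc j)"
      by (simp add: dvd_mult2 dvd_mult)
  qed
  then show ?thesis
    by (simp add: euler_sum_def sum.lessThan_Suc_shift V_0 del: sum.lessThan_Suc power_Suc)
qed

text \<open>Iterates the functional equation \<open>i\<close> times. For \<open>i = J\<close> the
  right-hand sum is 1 modulo \<open>q^J\<close>, which yields Euler's identity.\<close>

lemma euler_product_dvd:
  "q ^ J dvd (\<Prod>m<i. 1 + a * q ^ (k * m + 1)) * euler_sum 0 (Suc J) - euler_sum i (Suc J)"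
proof (induction i)
  case (Suc i)
  have "q ^ J dvd (1 + a * q ^ (k * i + 1)) * ((\<Prod>m<i. 1 + a * q ^ (k * m + 1)) * euler_sum 0 (Suc J))
      - (1 + a * q ^ (k * i + 1)) * euler_sum i (Suc J)"
    using Suc by (simp add: right_diff_distrib[symmetric])
  from dvd_diff_trans[OF this q_power_dvd_euler_sum_step] show ?case
    by (simp add: mult_ac)
qed simp

end

text \<open>Solving the recurrence for \<open>d N\<close> gives \<open>d (N+1)\<close> plus terms
  carrying a positive power of \<open>q\<close>. The outer induction raises the exponent by one
  through that power; the inner one descends in \<open>N\<close> to handle
  \<open>d (N+1)\<close>.\<close>

lemma q_recurrence_unique:
  fixes d :: "nat \<Rightarrow> 'a::comm_ring_1" and q :: 'a
  assumes rec: "\<And>N. 1 \<le> N \<Longrightarrow> q ^ J dvd (1 - q ^ N) * d N - d (Suc N) - a * q ^ Suc N * d (N + k)"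
    and large: "\<And>N. J < N \<Longrightarrow> q ^ J dvd d N"
    and "1 \<le> N"
  shows "q ^ J dvd d N"
proof -
  have "\<forall>N\<ge>1. q ^ i dvd d N" if "i \<le> J" for i
    using that
  proof (induction i)
    case (Suc i)
    then have IH: "q ^ i dvd d N" if "1 \<le> N" for N using that by simp
    have dvd_mult_IH: "q ^ Suc i dvd q ^ M * d N" if "1 \<le> N" "1 \<le> M" for M N
    proof -
      have "q ^ 1 * q ^ i dvd q ^ M * d N"
        using that IH by (intro mult_dvd_mono le_imp_power_dvd) auto
      then show ?thesis by simp
    qed
    have "q ^ Suc i dvd d N" if "1 \<le> N" for N
      using that
    \<comment> \<open>This distance is 0 exactly when \<open>N > J\<close>, where
      \<open>large\<close> applies.\<close>
    proof (induction "Suc J - N" arbitrary: N)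
      case 0
      then show ?case
        using large[of N] le_imp_power_dvd[OF \<open>Suc i \<le> J\<close>, of q] by (auto intro: dvd_trans)
    next
      case (Suc j)
      have "q ^ Suc i dvd d (Suc N)" using Suc.hyps Suc.prems by (intro Suc.hyps) auto
      moreover have "q ^ Suc i dvd q ^ N * d N" "q ^ Suc i dvd a * (q ^ Suc N * d (N + k))"
        using dvd_mult_IH[of N N] dvd_mult_IH[of "N + k" "Suc N"] Suc.prems
        by (auto simp del: power_Suc)
      moreover have "q ^ Suc i dvd (1 - q ^ N) * d N - d (Suc N) - a * q ^ Suc N * d (N + k)"
        using rec[OF Suc.prems] le_imp_power_dvd[OF \<open>Suc i \<le> J\<close>] by (rule dvd_trans[rotated])
      ultimately have "q ^ Suc i dvd ((1 - q ^ N) * d N - d (Suc N) - a * q ^ Suc N * d (N + k))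
         + d (Suc N) + q ^ N * d N + a * (q ^ Suc N * d (N + k))"
        by (intro dvd_add)
      then show ?case by (simp add: algebra_simps)
    qed
    then show ?case by blast
  qed simp
  then show ?thesis using \<open>1 \<le> N\<close> by blast
qed


section \<open>Admissible pairs\<close>

text \<open>Here \<open>M\<close> holds the non-overlined parts only, unlike the first component of
  an overpartition.\<close>

definition admissible :: "nat \<Rightarrow> nat multiset \<Rightarrow> nat set \<Rightarrow> bool" where
  "admissible k M S \<longleftrightarrow>
     (\<forall>b \<in> S. \<forall>c \<in> {b..b + k - 2}. c \<notin># M) \<and> (\<forall>b \<in> S. \<forall>c \<in> {b + 1..b + k - 1}. c \<notin> S)"

lemma admissible_empty [simp]: "admissible k M {}"
  by (simp add: admissible_def)

lemma admissible_add_mset: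
  assumes "\<forall>b\<in>S. N < b"
  shows "admissible k (add_mset N M) S \<longleftrightarrow> admissible k M S"
  using assms unfolding admissible_def by fastforce

text \<open>All parts are at least \<open>N\<close> already, so avoiding a window that starts at
  \<open>N\<close> or \<open>N + 1\<close> is a lower bound; windows of larger overlined parts do
  not reach down to \<open>N\<close>.\<close>

lemma admissible_insert:
  assumes "2 \<le> k" "\<forall>b\<in>#M. N \<le> b" "\<forall>b\<in>S. N < b"
  shows "admissible k M (insert N S) \<longleftrightarrow>
    admissible k M S \<and> (\<forall>b\<in>#M. N + k - 1 \<le> b) \<and> (\<forall>b\<in>S. N + k \<le> b)"
proof -
  have "(\<forall>c\<in>{N..N + k - 2}. c \<notin># M) \<longleftrightarrow> (\<forall>b\<in>#M. b \<notin> {N..N + k - 2})" by blast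
  also have "\<dots> \<longleftrightarrow> (\<forall>b\<in>#M. N + k - 1 \<le> b)"
    using assms by (intro ball_cong) auto
  finally have M: "(\<forall>c\<in>{N..N + k - 2}. c \<notin># M) \<longleftrightarrow> (\<forall>b\<in>#M. N + k - 1 \<le> b)" .
  have "(\<forall>c\<in>{N + 1..N + k - 1}. c \<notin> insert N S) \<longleftrightarrow> (\<forall>b\<in>S. b \<notin> {N + 1..N + k - 1})" by auto
  also have "\<dots> \<longleftrightarrow> (\<forall>b\<in>S. N + k \<le> b)"
    using assms by (intro ball_cong) auto
  finally have S: "(\<forall>c\<in>{N + 1..N + k - 1}. c \<notin> insert N S) \<longleftrightarrow> (\<forall>b\<in>S. N + k \<le> b)" .
  have S': "(\<forall>b\<in>S. \<forall>c\<in>{b + 1..b + k - 1}. c \<notin> insert N S) \<longleftrightarrow>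
      (\<forall>b\<in>S. \<forall>c\<in>{b + 1..b + k - 1}. c \<notin> S)"
    using assms(3) by (intro ball_cong) auto
  show ?thesis
    unfolding admissible_def ball_simps(7) M S S' by (intro iffI conjI; elim conjE; assumption)
qed

text \<open>Separate bounds are kept because an overlined part pushes the two kinds of parts to
  bounds that differ by one. Finiteness of \<open>S\<close> is explicit since sums and cardinalities
  of infinite sets default to 0.\<close>

definition gap_pairs :: "nat \<Rightarrow> nat \<Rightarrow> nat \<Rightarrow> nat \<Rightarrow> nat \<Rightarrow> (nat multiset \<times> nat set) set" where
  "gap_pairs k N L m n =
     {(M, S). (\<forall>b \<in># M. N \<le> b) \<and> finite S \<and> (\<forall>b \<in> S. L \<le> b) \<and>
       sum_mset M + \<Sum>S = n \<and> card S = m \<and> admissible k M S}"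

definition gap_count :: "nat \<Rightarrow> nat \<Rightarrow> nat \<Rightarrow> nat \<Rightarrow> nat \<Rightarrow> nat" where
  "gap_count k N L m n = card (gap_pairs k N L m n)"

lemma sum_mset_mset_set: "sum_mset (mset_set S) = \<Sum>S"
  by (simp add: sum_unfold_sum_mset)

lemma mset_set_subseteq_mset:
  assumes "S \<subseteq> set_mset P"
  shows "mset_set S \<subseteq># P"
  using assms subset_mset.order_trans[OF subset_imp_msubset_mset_set mset_set_set_mset_msubset]
  by blast

text \<open>Removing the overlined copies is reversible, as each overlined size occurs in
  \<open>P\<close>.\<close>

lemma D_eq_gap_count: "D k m n = gap_count k 1 1 m n"
  unfolding D_def gap_count_def
proof (rule bij_betw_same_card[OF bij_betw_byWitness[where
      f = "\<lambda>(P, S). (P - mset_set S, S)" and f' = "\<lambda>(M, S). (M + mset_set S, S)"]])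
  let ?f = "\<lambda>(P, S). (P - mset_set S, S)" and ?g = "\<lambda>(M, S). (M + mset_set S, S)"
  let ?D = "{\<pi> \<in> overpartitions n. card (overlined_parts \<pi>) = m \<and>
     (\<forall>b \<in> overlined_parts \<pi>. \<forall>c \<in> {b..b + k - 2}. c \<notin># nonoverlined_parts \<pi>) \<and>
     (\<forall>b \<in> overlined_parts \<pi>. \<forall>c \<in> {b + 1..b + k - 1}. c \<notin> overlined_parts \<pi>)}"
  have D_iff: "(P, S) \<in> ?D \<longleftrightarrow> (\<forall>b\<in>#P. 0 < b) \<and> sum_mset P = n \<and> S \<subseteq> set_mset P \<and> card S = m \<and>
      admissible k (P - mset_set S) S" for P S
    by (simp add: overpartitions_def admissible_def)
  have sub: "finite S" "mset_set S \<subseteq># P" if "(P, S) \<in> ?D" for P S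
    using that unfolding D_iff by (auto intro: mset_set_subseteq_mset finite_subset)
  show "\<forall>x\<in>?D. ?g (?f x) = x"
  proof
    fix x assume x: "x \<in> ?D"
    obtain P S where "x = (P, S)" by force
    then show "?g (?f x) = x" using sub(2)[of P S] x by simp
  qed
  show "\<forall>x\<in>gap_pairs k 1 1 m n. ?f (?g x) = x"
    by (auto simp: gap_pairs_def)
  show "?f ` ?D \<subseteq> gap_pairs k 1 1 m n"
  proof (rule image_subsetI)
    fix x assume x: "x \<in> ?D"
    obtain P S where PS: "x = (P, S)" by force
    have sub': "finite S" "mset_set S \<subseteq># P" using sub[of P S] x unfolding PS by blast+
    have "sum_mset (P - mset_set S) + \<Sum>S = sum_mset P"
      unfolding sum_mset_mset_set[symmetric] sum_mset.union[symmetric] subset_mset.diff_add[OF sub'(2)] ..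
    then show "?f x \<in> gap_pairs k 1 1 m n"
      using x sub'(1) unfolding PS D_iff prod.case
      by (auto simp: gap_pairs_def Suc_le_eq dest: in_diffD)
  qed
  show "?g ` gap_pairs k 1 1 m n \<subseteq> ?D"
  proof (rule image_subsetI)
    fix x assume x: "x \<in> gap_pairs k 1 1 m n"
    obtain M S where MS: "x = (M, S)" by force
    show "?g x \<in> ?D"
      using x unfolding MS prod.case D_iff by (auto simp: gap_pairs_def sum_mset_mset_set Suc_le_eq)
  qed
qed

text \<open>Positive parts bound the number of parts by \<open>n\<close>; a part 0 could be repeated
  freely.\<close>

lemma finite_gap_pairs:
  assumes "1 \<le> N"
  shows "finite (gap_pairs k N L m n)"
proof (rule finite_subset)
  show "finite (mset ` {xs. set xs \<subseteq> {..n} \<and> length xs \<le> n} \<times> Pow {..n})"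
    by (intro finite_cartesian_product finite_imageI finite_lists_length_le) auto
  show "gap_pairs k N L m n \<subseteq> mset ` {xs. set xs \<subseteq> {..n} \<and> length xs \<le> n} \<times> Pow {..n}"
  proof
    fix x assume x: "x \<in> gap_pairs k N L m n"
    obtain M S where "x = (M, S)" by force
    with x have MS: "(M, S) \<in> gap_pairs k N L m n" by simp
    obtain xs where xs: "M = mset xs" using ex_mset by metis
    have "length xs \<le> sum_list xs" if "\<forall>b\<in>set xs. 1 \<le> b" for xs :: "nat list"
      using that by (induction xs) auto
    then have "length xs \<le> n"
      using MS assms by (force simp: gap_pairs_def xs sum_mset_sum_list)
    moreover have "set xs \<subseteq> {..n}"
      using MS member_le_sum_list[of _ xs] by (force simp: gap_pairs_def xs sum_mset_sum_list)
    moreover have "S \<subseteq> {..n}"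
      using MS member_le_sum[of _ S id] by (force simp: gap_pairs_def)
    ultimately show "x \<in> mset ` {xs. set xs \<subseteq> {..n} \<and> length xs \<le> n} \<times> Pow {..n}"
      unfolding \<open>x = (M, S)\<close> xs by blast
  qed
qed

lemma gap_count_small:
  assumes "n < N" "N \<le> L"
  shows "gap_count k N L m n = (if m = 0 \<and> n = 0 then 1 else 0)"
proof -
  have "M = {#} \<and> S = {} \<and> m = 0 \<and> n = 0" if "(M, S) \<in> gap_pairs k N L m n" for M S
  proof -
    have "M = {#}"
    proof (rule ccontr)
      assume "M \<noteq> {#}"
      then obtain b M' where "M = add_mset b M'" by (metis multiset_cases)
      then show False using that assms by (auto simp: gap_pairs_def)
    qed
    moreover have "b \<le> \<Sum>S" if "finite S" "b \<in> S" for b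
      using member_le_sum[of b S id] that by simp
    then have "S = {}"
      using that assms by (fastforce simp: gap_pairs_def)
    ultimately show ?thesis using that by (auto simp: gap_pairs_def)
  qed
  moreover have "({#}, {}) \<in> gap_pairs k N L 0 0" by (simp add: gap_pairs_def)
  ultimately have "gap_pairs k N L m n = (if m = 0 \<and> n = 0 then {({#}, {})} else {})"
    by (auto simp del: split_paired_All split_paired_Ex)
  then show ?thesis by (simp add: gap_count_def)
qed

text \<open>If \<open>N\<close> occurs, one copy is removed. Further copies may remain, so the bound
  stays \<open>N\<close>; all overlined parts exceed \<open>N\<close>, so no condition is
  affected.\<close>

lemma gap_count_split_plain:
  assumes "1 \<le> N"
  shows "gap_count k N (Suc N) m n = gap_count k (Suc N) (Suc N) m n +
    (if N \<le> n then gap_count k N (Suc N) m (n - N) else 0)"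
proof -
  let ?f = "\<lambda>(M, S). (add_mset N M, S :: nat set)"
  let ?A = "if N \<le> n then gap_pairs k N (Suc N) m (n - N) else {}"
  have "gap_pairs k N (Suc N) m n = gap_pairs k (Suc N) (Suc N) m n \<union> ?f ` ?A" (is "?L = ?R1 \<union> ?R2")
  proof (intro equalityI subsetI)
    fix x assume x: "x \<in> ?L"
    obtain M S where MS: "x = (M, S)" by force
    show "x \<in> ?R1 \<union> ?R2"
    proof (cases "N \<in># M")
      case True
      then obtain M' where M': "M = add_mset N M'" by (metis multi_member_split)
      have "N \<le> n" "(M', S) \<in> gap_pairs k N (Suc N) m (n - N)"
        using x unfolding MS M' by (auto simp: gap_pairs_def admissible_add_mset Suc_le_eq)
      then show ?thesis unfolding MS M' by force
    next
      case False
      then have "\<forall>b\<in>#M. Suc N \<le> b"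
        using x by (auto simp: MS gap_pairs_def Suc_le_eq order_less_le)
      then have "x \<in> ?R1" using x by (simp add: MS gap_pairs_def)
      then show ?thesis by blast
    qed
  next
    fix x assume "x \<in> ?R1 \<union> ?R2"
    then show "x \<in> ?L"
      by (auto simp: gap_pairs_def admissible_add_mset Suc_le_eq order_less_imp_le split: if_splits)
  qed
  moreover have "N \<notin># fst x" if "x \<in> ?R1" for x
    using that by (fastforce simp: gap_pairs_def)
  moreover have "N \<in># fst x" if "x \<in> ?R2" for x
    using that by auto
  ultimately have split: "?L = ?R1 \<union> ?R2" "?R1 \<inter> ?R2 = {}" by blast+
  moreover have "inj_on ?f ?A" by (auto simp: inj_on_def)
  ultimately show ?thesis
    using assms split(2)
    by (simp add: gap_count_def split(1) card_Un_disjoint finite_gap_pairs card_image)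
qed

text \<open>If \<open>N\<close> is overlined, then conditions (i) and (ii) push the remaining non-overlined and
  overlined parts up to at least \<open>N + k - 1\<close> and \<open>N + k\<close>.\<close>

lemma gap_count_split_overlined:
  assumes "1 \<le> N" "2 \<le> k"
  shows "gap_count k N N m n = gap_count k N (Suc N) m n +
    (if N \<le> n \<and> 1 \<le> m then gap_count k (N + k - 1) (N + k) (m - 1) (n - N) else 0)"
proof -
  let ?f = "\<lambda>(M :: nat multiset, S). (M, insert N S)"
  let ?A = "if N \<le> n \<and> 1 \<le> m then gap_pairs k (N + k - 1) (N + k) (m - 1) (n - N) else {}"
  have "gap_pairs k N N m n = gap_pairs k N (Suc N) m n \<union> ?f ` ?A" (is "?L = ?R1 \<union> ?R2")
  proof (intro equalityI subsetI)
    fix x assume x: "x \<in> ?L"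
    obtain M S where MS: "x = (M, S)" by force
    show "x \<in> ?R1 \<union> ?R2"
    proof (cases "N \<in> S")
      case True
      define S' where "S' = S - {N}"
      have S: "S = insert N S'" "N \<notin> S'" using True by (auto simp: S'_def)
      have N: "\<forall>b\<in>#M. N \<le> b" "\<forall>b\<in>S'. N < b"
        using x S by (auto simp: MS gap_pairs_def order_less_le)
      have "N \<le> n \<and> 1 \<le> m" "(M, S') \<in> gap_pairs k (N + k - 1) (N + k) (m - 1) (n - N)"
        using x S(2) unfolding MS S(1)
        by (auto simp: gap_pairs_def admissible_insert[OF assms(2) N])
      then show ?thesis unfolding MS S(1) by force
    next
      case False
      then have "\<forall>b\<in>S. Suc N \<le> b"
        using x by (auto simp: MS gap_pairs_def Suc_le_eq order_less_le)
      then have "x \<in> ?R1" using x by (simp add: MS gap_pairs_def)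
      then show ?thesis by blast
    qed
  next
    fix x assume "x \<in> ?R1 \<union> ?R2"
    then show "x \<in> ?L"
    proof
      assume "x \<in> ?R1"
      then show ?thesis by (auto simp: gap_pairs_def dest: Suc_leD)
    next
      assume "x \<in> ?R2"
      then obtain M S where x: "x = (M, insert N S)" and le: "N \<le> n" "1 \<le> m"
        and MS: "(M, S) \<in> gap_pairs k (N + k - 1) (N + k) (m - 1) (n - N)"
        by (auto split: if_splits)
      have N: "\<forall>b\<in>#M. N \<le> b" "\<forall>b\<in>S. N < b"
        using MS assms by (fastforce simp: gap_pairs_def)+
      then have "N \<notin> S" by blast
      then show ?thesis
        using le MS N unfolding x
        by (auto simp: gap_pairs_def admissible_insert[OF assms(2) N] order_less_imp_le)
    qed
  qed
  moreover have "N \<notin> snd x" if "x \<in> ?R1" for x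
    using that by (fastforce simp: gap_pairs_def)
  moreover have "N \<in> snd x" if "x \<in> ?R2" for x
    using that by auto
  ultimately have split: "?L = ?R1 \<union> ?R2" "?R1 \<inter> ?R2 = {}" by blast+
  \<comment> \<open>Inserting \<open>N\<close> can be undone because all elements of
    \<open>S\<close> are at least \<open>N + k\<close>.\<close>
  moreover have "inj_on ?f ?A"
  proof -
    have "N \<notin> S" if "(M, S) \<in> ?A" for M S
      using that assms by (auto simp: gap_pairs_def split: if_splits)
    then show ?thesis by (fastforce simp: inj_on_def insert_ident)
  qed
  ultimately show ?thesis
    using assms split(2)
    by (simp add: gap_count_def split(1) card_Un_disjoint finite_gap_pairs card_image)
qed

section \<open>The generating function\<close>

lemma gen_fun_nth [simp]: "gen_fun f $ n $ m = of_nat (f m n)"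
  by (simp add: gen_fun_def)

lemma var_a_mult_var_q_power_mult_nth:
  "(var_a * var_q ^ N * F) $ n $ m = (if N \<le> n \<and> 1 \<le> m then F $ (n - N) $ (m - 1) else 0)"
  by (auto simp: mult.assoc fps_X_power_mult_nth)

lemma gen_fun_gap_count_split_plain:
  assumes "1 \<le> N"
  shows "(1 - var_q ^ N) * gen_fun (gap_count k N (Suc N)) = gen_fun (gap_count k (Suc N) (Suc N))"
proof -
  have "gen_fun (gap_count k N (Suc N)) =
      gen_fun (gap_count k (Suc N) (Suc N)) + var_q ^ N * gen_fun (gap_count k N (Suc N))"
    by (intro fps_ext)
       (auto simp: fps_X_power_mult_nth gap_count_split_plain[OF assms, of k])
  then show ?thesis by (simp add: algebra_simps)
qed

text \<open>The bounds in the last series are again consecutive, so it belongs to the family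
  \<open>A\<close> at index \<open>N + k - 1\<close>.\<close>

lemma gen_fun_gap_count_split_overlined:
  assumes "1 \<le> N" "2 \<le> k"
  shows "gen_fun (gap_count k N N) = gen_fun (gap_count k N (Suc N)) +
    var_a * var_q ^ N * gen_fun (gap_count k (N + k - 1) (N + k))"
  by (intro fps_ext)
     (simp add: var_a_mult_var_q_power_mult_nth gap_count_split_overlined[OF assms] del: One_nat_def)

theorem theorem4:
  fixes k :: nat
  assumes "k \<ge> 2"
  shows "gen_fun (D k) =
    qpochhammer_inf (- var_a * var_q) (var_q ^ k) / qpochhammer_inf var_q var_q"
proof -
  define P where "P = qpochhammer_inf (- var_a * var_q) (var_q ^ k)"
  define Q where "Q = qpochhammer_inf var_q var_q"
  define V where "V j = inverse (\<Prod>i<j. 1 - var_q ^ (k * Suc i))" for j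
  \<comment> \<open>\<open>1 / (q^N; q)_\<infinity>\<close> is written as
    \<open>(q; q)_(N-1) / (q; q)_\<infinity>\<close>, which makes \<open>R 1\<close> the inverse of
    \<open>Q\<close>.\<close>
  define R where "R N = inverse Q * (\<Prod>i<N - 1. 1 - var_q ^ Suc i)" for N
  define A where "A N = gen_fun (gap_count k N (Suc N))" for N

  have Q0: "Q $ 0 = 1" by (simp add: Q_def qpochhammer_inf_nth_0)
  have QR: "Q * R 1 = 1" using fps_mult_inverse_of_unit_constant[OF Q0] by (simp add: R_def)
  have prod0: "(\<Prod>i<j. 1 - var_q ^ (k * Suc i)) $ 0 = 1" for j
    using assms by (induction j) auto

  interpret q_recurrence var_q var_a k V R
  proof
    show "V 0 = 1" by (simp add: V_def fps_inverse_one')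
    show "(1 - var_q ^ (k * Suc j)) * V (Suc j) = V j" for j
    proof -
      define x y where "x = (\<Prod>i<j. 1 - var_q ^ (k * Suc i))" and "y = 1 - var_q ^ (k * Suc j)"
      have x: "x * V j = 1" and xy: "(x * y) * V (Suc j) = 1"
        using fps_mult_inverse_of_unit_constant[OF prod0, of j]
          fps_mult_inverse_of_unit_constant[OF prod0, of "Suc j"]
        by (simp_all add: V_def x_def y_def)
      have "y * V (Suc j) = (x * V j) * (y * V (Suc j))" by (simp only: x mult_1)
      also have "\<dots> = ((x * y) * V (Suc j)) * V j" by (simp only: mult_ac)
      also have "\<dots> = V j" by (simp only: xy mult_1)
      finally show ?thesis by (simp only: y_def)
    qed
    show "(1 - var_q ^ N) * R N = R (Suc N)" if "1 \<le> N" for N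
      using that by (cases N) (auto simp: R_def mult_ac)
    show "1 \<le> k" using assms by simp
  qed

  \<comment> \<open>\<open>Q * R (Suc N)\<close> is the product of the first \<open>N\<close>
    factors of \<open>Q\<close>, hence congruent to \<open>Q\<close>; multiplying by
    \<open>R 1\<close> cancels \<open>Q\<close>.\<close>
  have R_dvd: "var_q ^ N dvd R (Suc N) - 1" for N
  proof -
    have "(\<Prod>m<N. 1 - var_q * var_q ^ m) = Q * R (Suc N)"
      using QR by (simp add: R_def mult.assoc[symmetric])
    then have "var_q ^ N dvd Q * 1 - Q * R (Suc N)"
      using qpochhammer_inf_dvd[of var_q var_q N] by (simp add: Q_def)
    then have "var_q ^ N dvd R 1 * (Q * 1 - Q * R (Suc N))" by (rule dvd_mult)
    also have "R 1 * (Q * 1 - Q * R (Suc N)) = Q * R 1 * (1 - R (Suc N))"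
      by (simp only: algebra_simps)
    finally have "var_q ^ N dvd 1 - R (Suc N)" unfolding QR by simp
    then show ?thesis using dvd_minus_iff[of "var_q ^ N" "1 - R (Suc N)"] by simp
  qed

  have euler: "var_q ^ J dvd P * euler_sum 0 (Suc J) - 1" for J
  proof -
    have "var_q ^ J dvd P - (\<Prod>m<J. 1 - (- var_a * var_q) * (var_q ^ k) ^ m)"
      unfolding P_def using assms by (intro qpochhammer_inf_dvd) auto
    then have "var_q ^ J dvd P - (\<Prod>m<J. 1 + var_a * var_q ^ (k * m + 1))"
      by (simp add: power_mult mult.assoc del: fps_const_neg)
    then have "var_q ^ J dvd P * euler_sum 0 (Suc J) -
        (\<Prod>m<J. 1 + var_a * var_q ^ (k * m + 1)) * euler_sum 0 (Suc J)"
      by (intro dvd_diff_mult) auto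
    then show ?thesis
      using euler_product_dvd[of J J] euler_sum_dvd[of J J] by (blast intro: dvd_diff_trans)
  qed

  \<comment> \<open>Replacing each \<open>R\<close> by 1 turns \<open>sol\<close> into Euler's
    sum.\<close>
  have sol_init: "var_q ^ N dvd sol (Suc J) (Suc N) - euler_sum 0 (Suc J)" for N J
  proof -
    have "var_q ^ N dvd sol_term (Suc N) j - (- var_a * var_q) ^ j * V j * 1" for j
    proof -
      have "var_q ^ N dvd R (Suc N + k * j) - 1"
        using R_dvd[of "N + k * j"] le_imp_power_dvd[of N "N + k * j" var_q] by (auto intro: dvd_trans)
      then show ?thesis unfolding sol_term_def by (intro dvd_diff_mult) auto
    qed
    then have "var_q ^ N dvd (\<Sum>j<Suc J. sol_term (Suc N) j - (- var_a * var_q) ^ j * V j * 1)"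
      by (intro dvd_sum) auto
    then show ?thesis by (simp add: sol_def euler_sum_def sum_subtractf)
  qed

  have "var_q ^ J dvd gen_fun (D k) - P * R 1" for J
  proof -
    \<comment> \<open>The error of the candidate solution: it satisfies the recurrence modulo
      \<open>q^J\<close> and vanishes modulo \<open>q^J\<close> for \<open>N > J\<close>.\<close>
    define d where "d N = A N - P * sol (Suc J) N" for N
    \<comment> \<open>The overlined split is taken at \<open>N + 1\<close>, so its last index is
      \<open>(N + 1) + k - 1 = N + k\<close>.\<close>
    have A_rec: "(1 - var_q ^ N) * A N - A (Suc N) - var_a * var_q ^ Suc N * A (N + k) = 0"
      if "1 \<le> N" for N
      using gen_fun_gap_count_split_plain[OF that, of k]
        gen_fun_gap_count_split_overlined[of "Suc N" k] assms by (simp add: A_def)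
    have d_dvd: "var_q ^ J dvd d N" if "1 \<le> N" for N
    proof (rule q_recurrence_unique[OF _ _ that])
      fix N :: nat assume N: "1 \<le> N"
      have "(1 - var_q ^ N) * d N - d (Suc N) - var_a * var_q ^ Suc N * d (N + k) =
          ((1 - var_q ^ N) * A N - A (Suc N) - var_a * var_q ^ Suc N * A (N + k)) -
          P * ((1 - var_q ^ N) * sol (Suc J) N - sol (Suc J) (Suc N)
            - var_a * var_q ^ Suc N * sol (Suc J) (N + k))"
        by (simp add: d_def algebra_simps)
      also have "\<dots> = P * (var_a * var_q ^ Suc N * sol_term (N + k) J)"
        unfolding A_rec[OF N] sol_recurrence[OF N] by simp
      finally show "var_q ^ J dvd
          (1 - var_q ^ N) * d N - d (Suc N) - var_a * var_q ^ Suc N * d (N + k)"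
        using sol_term_dvd[of J "N + k"] by simp
    next
      fix N assume "J < N"
      then obtain N' where N': "N = Suc N'" "J \<le> N'" by (cases N) auto
      have "var_q ^ J dvd A N - 1"
        using \<open>J < N\<close> unfolding fps_X_power_dvd_diff_iff
        by (auto simp: A_def fps_eq_iff gap_count_small)
      moreover have "var_q ^ J dvd sol (Suc J) N - euler_sum 0 (Suc J)"
        unfolding N'(1) using sol_init le_imp_power_dvd[OF N'(2)] by (rule dvd_trans[rotated])
      then have "var_q ^ J dvd P * sol (Suc J) N - P * euler_sum 0 (Suc J)"
        by (intro dvd_diff_mult) auto
      then have "var_q ^ J dvd P * sol (Suc J) N - 1"
        using euler by (rule dvd_diff_trans)
      then have "var_q ^ J dvd 1 - P * sol (Suc J) N"
        using dvd_minus_iff[of "var_q ^ J" "P * sol (Suc J) N - 1"] by simp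
      ultimately show "var_q ^ J dvd d N"
        unfolding d_def by (rule dvd_diff_trans)
    qed
    have "gen_fun (D k) = A 1 + var_a * var_q * A k"
      using gen_fun_gap_count_split_overlined[of 1 k] assms
      by (simp add: A_def D_eq_gap_count[abs_def])
    \<comment> \<open>Substituting \<open>A = d + P * sol\<close> isolates the combination that
      \<open>sol_total\<close> collapses to a boundary term divisible by \<open>q^J\<close>.\<close>
    then have "gen_fun (D k) - P * R 1 =
        d 1 + var_a * var_q * d k + P * ((sol (Suc J) 1 + var_a * var_q * sol (Suc J) k) - R 1)"
      by (simp add: d_def algebra_simps)
    also have "\<dots> = d 1 + var_a * var_q * d k + P * (var_a * var_q * sol_term k J)"
      unfolding sol_total by simp
    finally show ?thesis
      using d_dvd[of 1] d_dvd[of k] sol_term_dvd[of J k] assms by simp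
  qed
  then have "gen_fun (D k) = P * inverse Q"
    by (simp add: fps_eqI_fps_X_power_dvd R_def)
  moreover have "P / Q = P * inverse Q" using Q0 by (intro fps_divide_unit) simp
  ultimately show ?thesis by (simp add: P_def Q_def)
qed

end
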